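(* Let $R$ be a commutative ring and $X$ an indeterminate over $R$. Then the following are equivalent. (1) $R$ is a finite direct product of integral domains. (2) $X$ is a product of prime elements of $R[X]$. (3) Each $X^n$, $n\ge 1$, is a product of prime elements of $R[X]$. (4) For some $n\ge 1$, $X^n$ is a product of prime elements of $R[X]$.
   Context: All rings are commutative with identity $1\neq 0$. An element $p$ of a ring $A$ is prime if it is a nonunit and $p\mid ab$ with $a,b\in A$ implies $p\mid a$ or $p\mid b$ (i.e. $Ap$ is a prime ideal). Products and direct products are finite with at least one factor. *)

theory Defs
  imports
    "HOL-Algebra.Divisibility"
    "HOL-Algebra.UnivPoly"
    "HOL-Algebra.Chinese_Remainder"
begin

text \<open>
  HOL cannot quantify over types inside a formula, so the factors below are taken to be rings
  on the carrier type of \<open>R\<close>. The lemma \<open>finite_product_of_domainsI\<close> shows that this is no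
  restriction: integral domains over an arbitrary type yield the same notion. The type constraint
  \<open>'a ring\<close> does not restrict the carriers, which are arbitrary subsets of the type.
\<close>

definition finite_product_of_domains :: "('a, 'm) ring_scheme \<Rightarrow> bool" where
  "finite_product_of_domains R \<longleftrightarrow>
    (\<exists>Ds :: 'a ring list. Ds \<noteq> [] \<and> (\<forall>D \<in> set Ds. domain D) \<and> R \<simeq> RDirProd_list Ds)"

text \<open>
  \<^const>\<open>prime\<close> is the predicate of \<^theory>\<open>HOL-Algebra.Divisibility\<close>: a nonunit \<open>p\<close> such that
  \<open>p\<close> divides \<open>a\<close> or \<open>b\<close> whenever it divides \<open>a \<otimes> b\<close>. It does not exclude \<open>p = \<zero>\<close>, in contrast to
  \<open>ring_prime\<close> and \<open>prime_elem\<close>. The product has at least one factor.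
\<close>

definition product_of_primes :: "('a, 'm) monoid_scheme \<Rightarrow> 'a \<Rightarrow> bool" where
  "product_of_primes G a \<longleftrightarrow>
    (\<exists>ps. ps \<noteq> [] \<and> set ps \<subseteq> carrier G \<and> (\<forall>p \<in> set ps. prime G p) \<and>
      foldr (\<otimes>\<^bsub>G\<^esub>) ps \<one>\<^bsub>G\<^esub> = a)"

definition UP_X :: "('a, 'm) ring_scheme \<Rightarrow> nat \<Rightarrow> 'a" where
  "UP_X R = monom (UP R) \<one>\<^bsub>R\<^esub> 1"

lemma RDirProd_list_cong_iso:
  assumes "list_all2 (\<simeq>) Rs Ss"
  shows "RDirProd_list Rs \<simeq> RDirProd_list Ss"
  using assms
proof (induction rule: list_all2_induct)
  case Nil
  have "(\<lambda>_. []) \<in> ring_iso nil_ring nil_ring"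
    by (auto simp: ring_iso_def ring_hom_def bij_betw_def monoid.defs)
  then show ?case
    by (auto simp: is_ring_iso_def)
next
  case (Cons R Rs S Ss)
  then obtain f g where "f \<in> ring_iso R S" "g \<in> ring_iso (RDirProd_list Rs) (RDirProd_list Ss)"
    by (auto simp: is_ring_iso_def)
  from ring_iso_set_trans[OF ring_iso_set_trans[OF RDirProd_list_iso2 RDirProd_iso6[OF this]]
      RDirProd_list_iso1]
  show ?case
    by (auto simp: is_ring_iso_def)
qed

lemma finite_product_of_domainsI:
  fixes R :: "('a, 'm) ring_scheme" and Ss :: "('b, 'n) ring_scheme list"
  assumes R: "ring R" and ne: "Ss \<noteq> []" and dom: "\<And>S. S \<in> set Ss \<Longrightarrow> domain S"
    and iso: "R \<simeq> RDirProd_list Ss"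
  shows "finite_product_of_domains R"
proof -
  have rings: "ring S" if "S \<in> set Ss" for S
    using dom[OF that] by (simp add: cring.axioms(1) domain.axioms(1))
  from iso ring_iso_sym[OF R] obtain k where k: "k \<in> ring_iso (RDirProd_list Ss) R"
    by (auto simp: is_ring_iso_def)
  then have k_inj: "inj_on k (carrier (RDirProd_list Ss))"
    by (auto simp: ring_iso_def bij_betw_def)
  have "\<exists>e :: 'b \<Rightarrow> 'a. inj_on e (carrier (Ss ! i))" if i: "i < length Ss" for i
  proof -
    define v where "v x = (map (\<lambda>S. \<zero>\<^bsub>S\<^esub>) Ss)[i := x]" for x
    have "v x \<in> carrier (RDirProd_list Ss)" if "x \<in> carrier (Ss ! i)" for x
    proof (rule RDirProd_list_carrier_memI)
      fix j assume j: "j < length Ss"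
      then show "v x ! j \<in> carrier (Ss ! j)"
        using that i rings[of "Ss ! j"] ring.ring_simprules(2)[of "Ss ! j"]
        by (cases "j = i") (auto simp: v_def)
    qed (simp add: v_def)
    moreover have "inj v"
    proof
      fix x y assume "v x = v y"
      then have "v x ! i = v y ! i" by simp
      then show "x = y" using i by (simp add: v_def)
    qed
    ultimately have "inj_on (k \<circ> v) (carrier (Ss ! i))"
      by (intro comp_inj_on inj_on_subset[OF k_inj]) (auto intro: inj_on_subset)
    then show ?thesis by blast
  qed
  then obtain e :: "nat \<Rightarrow> 'b \<Rightarrow> 'a"
    where e: "\<And>i. i < length Ss \<Longrightarrow> inj_on (e i) (carrier (Ss ! i))"
    by metis
  define Ds where "Ds = map (\<lambda>i. image_ring (e i) (Ss ! i)) [0..<length Ss]"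
  have "list_all2 (\<simeq>) Ss Ds"
    unfolding list_all2_conv_all_nth Ds_def is_ring_iso_def
    using inj_imp_image_ring_iso[OF e] by auto
  then obtain f g where "f \<in> ring_iso R (RDirProd_list Ss)"
    and "g \<in> ring_iso (RDirProd_list Ss) (RDirProd_list Ds)"
    using iso RDirProd_list_cong_iso by (force simp: is_ring_iso_def)
  from ring_iso_set_trans[OF this] have "R \<simeq> RDirProd_list Ds"
    by (auto simp: is_ring_iso_def)
  moreover have "\<forall>D \<in> set Ds. domain D"
    by (auto simp: Ds_def intro!: domain.inj_imp_image_ring_is_domain[OF dom] e)
  moreover have "Ds \<noteq> []"
    using ne by (simp add: Ds_def)
  ultimately show ?thesis
    unfolding finite_product_of_domains_def by blast
qed

end

theory Submission
  imports Defs "HOL-Algebra.Multiplicative_Group"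
begin

text \<open>
  The bridge between the two sides is a finite set \<open>F\<close> of idempotent prime elements of \<open>R\<close> such that
  only \<open>\<zero>\<close> is divisible by every \<open>f \<in> F\<close>, that is, \<open>\<Inter>f\<in>F. f R = 0\<close>. Distinct idempotent primes
  \<open>f\<close> and \<open>g\<close> satisfy \<open>(1 - f) (1 - g) = 0\<close>, so they generate comaximal ideals
  (\<open>complements_orthogonal\<close>).

  If \<open>R\<close> is a product of domains, then the tuples with one component \<open>0\<close> and the others \<open>1\<close> form
  such a set. Conversely, the ideals \<open>f R\<close> are prime, pairwise comaximal and have intersection \<open>0\<close>,
  and the Chinese remainder theorem writes \<open>R\<close> as the product of the domains \<open>R / f R\<close>.

  Given \<open>F\<close>, put \<open>p\<^sub>f = (1 - f) X + f\<close>. This polynomial divides \<open>h\<close> iff \<open>f\<close> divides \<open>h(0)\<close>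
  (\<open>partial_X_divides_iff\<close>), so it is prime, and \<open>p\<^sub>f p\<^sub>g = p\<^sub>f\<^sub>g\<close> as soon as \<open>(1 - f) (1 - g) = 0\<close>.
  The product of the elements of \<open>F\<close> is \<open>0\<close>, hence the product of the \<open>p\<^sub>f\<close> is \<open>p\<^sub>0 = X\<close>.

  Finally, let \<open>X^n\<close> with \<open>n \<ge> 1\<close> be a product of primes. Each prime factor \<open>p\<close> divides \<open>X\<close>, say
  \<open>X = p q\<close> with \<open>p = a + b X + \<dots>\<close> and \<open>q = c + d X + \<dots>\<close>. Comparing coefficients gives
  \<open>a c = 0\<close> and \<open>a d + b c = 1\<close>, so \<open>f = a d\<close> and \<open>e = b c\<close> are complementary idempotents, and \<open>f\<close>
  turns out to be prime (\<open>idempotent_prime_of_prime_divides_X\<close>). The constant terms \<open>a\<close> of all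
  the factors have product \<open>0\<close>, and \<open>a\<close> divides \<open>f\<close>, so only \<open>0\<close> is divisible by all these \<open>f\<close>.
\<close>

section \<open>Idempotent prime elements\<close>

text \<open>
  A finite set of idempotent primes whose principal ideals intersect in \<open>\<zero>\<close>. Divisibility by all
  members is used in place of their product, so that repeated members of a list do not matter.
  As \<^const>\<open>prime\<close> does not exclude \<open>\<zero>\<close>, the set is \<open>{\<zero>}\<close> when \<open>R\<close> is a domain.
\<close>

definition separating_idempotent_primes :: "('a, 'm) ring_scheme \<Rightarrow> 'a set \<Rightarrow> bool" where
  "separating_idempotent_primes R F \<longleftrightarrow>
    finite F \<and> F \<subseteq> carrier R \<and> (\<forall>f \<in> F. f \<otimes>\<^bsub>R\<^esub> f = f \<and> prime R f) \<and>
    (\<forall>r \<in> carrier R. (\<forall>f \<in> F. f divides\<^bsub>R\<^esub> r) \<longrightarrow> r = \<zero>\<^bsub>R\<^esub>)"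

lemma (in cring) idempotent_divides_iff:
  assumes "f \<in> carrier R" "x \<in> carrier R" "f \<otimes> f = f"
  shows "f divides x \<longleftrightarrow> f \<otimes> x = x"
  using assms by (metis dividesE dividesI m_assoc)

lemma (in cring) idempotent_divides_iff_complement:
  assumes "f \<in> carrier R" "x \<in> carrier R" "f \<otimes> f = f"
  shows "f divides x \<longleftrightarrow> (\<one> \<ominus> f) \<otimes> x = \<zero>"
proof -
  have "(\<one> \<ominus> f) \<otimes> x = x \<ominus> f \<otimes> x"
    using assms(1,2) by algebra
  then show ?thesis
    using assms r_right_minus_eq[of x "f \<otimes> x"] by (auto simp: idempotent_divides_iff)
qed

lemma (in cring) prime_not_one:
  assumes "prime R f"
  shows "f \<noteq> \<one>"
  using assms by (auto simp: prime_def)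

lemma (in cring) idempotent_primeI:
  assumes "f \<in> carrier R" "f \<otimes> f = f" "f \<noteq> \<one>"
    and "\<And>r s. \<lbrakk>r \<in> carrier R; s \<in> carrier R; f divides r \<otimes> s\<rbrakk> \<Longrightarrow> f divides r \<or> f divides s"
  shows "prime R f"
proof -
  have "f \<notin> Units R"
    using assms(1-3) by (metis one_closed r_one Units_l_cancel)
  then show ?thesis
    using assms(4) by (auto simp: prime_def)
qed

text \<open>
  The prime \<open>f\<close> divides \<open>0 = g (1 - g)\<close>, and \<open>f\<close> divides \<open>1 - g\<close> exactly if the claim holds. The
  remaining case, \<open>f\<close> and \<open>g\<close> dividing each other, forces \<open>f = g\<close> because both are idempotent.
\<close>

lemma (in cring) complements_orthogonal:
  assumes f: "f \<in> carrier R" "f \<otimes> f = f" "prime R f"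
    and g: "g \<in> carrier R" "g \<otimes> g = g" "prime R g" and ne: "f \<noteq> g"
  shows "(\<one> \<ominus> f) \<otimes> (\<one> \<ominus> g) = \<zero>"
proof (rule ccontr)
  assume neq: "(\<one> \<ominus> f) \<otimes> (\<one> \<ominus> g) \<noteq> \<zero>"
  have div: "h divides k"
    if h: "h \<in> carrier R" "h \<otimes> h = h" "prime R h"
      and k: "k \<in> carrier R" "k \<otimes> k = k"
      and nz: "(\<one> \<ominus> h) \<otimes> (\<one> \<ominus> k) \<noteq> \<zero>" for h k
  proof -
    have "k \<otimes> (\<one> \<ominus> k) = k \<ominus> k \<otimes> k"
      using k(1) by algebra
    then have "k \<otimes> (\<one> \<ominus> k) = \<zero>"
      using k by simp
    then have "h divides k \<otimes> (\<one> \<ominus> k)"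
      using h k by (simp add: idempotent_divides_iff)
    then have "h divides k \<or> h divides (\<one> \<ominus> k)"
      using h(3) k(1) by (simp add: prime_def)
    then show ?thesis
      using nz h k by (simp add: idempotent_divides_iff_complement)
  qed
  have "(\<one> \<ominus> g) \<otimes> (\<one> \<ominus> f) \<noteq> \<zero>"
    using neq f(1) g(1) m_comm[of "\<one> \<ominus> f" "\<one> \<ominus> g"] by simp
  then have "f \<otimes> g = g" "g \<otimes> f = f"
    using div[OF f g(1,2) neq] div[OF g f(1,2)] f g by (simp_all add: idempotent_divides_iff)
  then show False
    using ne m_comm[OF f(1) g(1)] by simp
qed

section \<open>Finite products of domains\<close>

lemma RDirProd_list_nth_hom:
  assumes "i < length Rs"
  shows "(\<lambda>xs. xs ! i) \<in> ring_hom (RDirProd_list Rs) (Rs ! i)"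
  using assms
proof (induction Rs arbitrary: i)
  case (Cons R Rs)
  let ?P = "RDirProd_list (R # Rs)"
  have ops: "(a # as) \<otimes>\<^bsub>?P\<^esub> (b # bs) = (a \<otimes>\<^bsub>R\<^esub> b) # (as \<otimes>\<^bsub>RDirProd_list Rs\<^esub> bs)"
    "(a # as) \<oplus>\<^bsub>?P\<^esub> (b # bs) = (a \<oplus>\<^bsub>R\<^esub> b) # (as \<oplus>\<^bsub>RDirProd_list Rs\<^esub> bs)"
    if "a \<in> carrier R" "b \<in> carrier R" "as \<in> carrier (RDirProd_list Rs)"
      "bs \<in> carrier (RDirProd_list Rs)" for a b as bs
    using ring_hom_mult[OF RDirProd_list_hom1, of "(a, as)" R Rs "(b, bs)"]
      ring_hom_add[OF RDirProd_list_hom1, of "(a, as)" R Rs "(b, bs)"] that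
    by (simp_all add: RDirProd_carrier, simp_all add: RDirProd_def DirProd_def monoid.defs)
  have one: "\<one>\<^bsub>?P\<^esub> = \<one>\<^bsub>R\<^esub> # \<one>\<^bsub>RDirProd_list Rs\<^esub>"
    by (simp add: RDirProd_list_one)
  show ?case
  proof (cases i)
    case 0
    then show ?thesis
      by (auto simp: ring_hom_def RDirProd_list_carrier ops one)
  next
    case (Suc j)
    then have "(\<lambda>xs. xs ! j) \<in> ring_hom (RDirProd_list Rs) (Rs ! j)"
      using Cons by simp
    then show ?thesis
      using Suc by (auto simp: ring_hom_def RDirProd_list_carrier ops one)
  qed
qed simp

lemma (in cring) separating_idempotent_primes_if_product:
  assumes "finite_product_of_domains R"
  shows "\<exists>F. separating_idempotent_primes R F"
proof -
  obtain Ds :: "'a ring list" and h where dom: "\<And>D. D \<in> set Ds \<Longrightarrow> domain D"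
    and h: "h \<in> ring_iso R (RDirProd_list Ds)"
    using assms by (auto simp: finite_product_of_domains_def is_ring_iso_def)
  define n where "n = length Ds"
  \<comment> \<open>The projections \<open>\<phi> i\<close> are jointly injective, so all identities in \<open>R\<close> are checked under them.\<close>
  define \<phi> where "\<phi> i x = h x ! i" for i x
  have domi: "domain (Ds ! i)" if "i < n" for i
    using that dom by (simp add: n_def)
  have hom: "\<phi> i \<in> ring_hom R (Ds ! i)" if "i < n" for i
    using ring_hom_trans[OF _ RDirProd_list_nth_hom, of h R Ds i] h that
    by (auto simp: ring_iso_def n_def comp_def \<phi>_def[abs_def])
  have phi_zero: "\<phi> i \<zero> = \<zero>\<^bsub>Ds ! i\<^esub>" if "i < n" for i
    using ring_hom_zero[OF hom[OF that] ring_axioms] domi[OF that]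
    by (simp add: cring.axioms(1) domain.axioms(1))
  have h_car: "h x \<in> carrier (RDirProd_list Ds)" if "x \<in> carrier R" for x
    using h that by (auto simp: ring_iso_def ring_hom_def)
  have inj: "x = y" if "x \<in> carrier R" "y \<in> carrier R" "\<And>i. i < n \<Longrightarrow> \<phi> i x = \<phi> i y" for x y
  proof -
    have "h x = h y"
      using that RDirProd_list_carrier_mem(1)[OF h_car[of x]] RDirProd_list_carrier_mem(1)[OF h_car[of y]]
      by (auto simp: list_eq_iff_nth_eq \<phi>_def n_def)
    then show ?thesis
      using h that(1,2) by (auto simp: ring_iso_def bij_betw_def inj_on_def)
  qed
  have "\<exists>f \<in> carrier R. \<forall>i < n. \<phi> i f = (if i = j then \<zero>\<^bsub>Ds ! i\<^esub> else \<one>\<^bsub>Ds ! i\<^esub>)" for j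
  proof -
    define u where "u = map (\<lambda>i. if i = j then \<zero>\<^bsub>Ds ! i\<^esub> else \<one>\<^bsub>Ds ! i\<^esub>) [0..<n]"
    have "u \<in> carrier (RDirProd_list Ds)"
    proof (rule RDirProd_list_carrier_memI)
      fix i assume "i < length Ds"
      then interpret D: "domain" "Ds ! i"
        using domi by (simp add: n_def)
      show "u ! i \<in> carrier (Ds ! i)"
        using \<open>i < length Ds\<close> D.zero_closed D.one_closed
        by (cases "i = j") (simp_all add: u_def n_def)
    qed (simp add: u_def n_def)
    then obtain f where "f \<in> carrier R" "h f = u"
      using h unfolding ring_iso_def bij_betw_def by (auto elim!: equalityE dest!: subsetD)
    then show ?thesis
      by (intro bexI[of _ f]) (auto simp: \<phi>_def u_def)
  qed
  then obtain f where f: "\<And>j. f j \<in> carrier R"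
    and phi_f: "\<And>i j. i < n \<Longrightarrow> \<phi> i (f j) = (if i = j then \<zero>\<^bsub>Ds ! i\<^esub> else \<one>\<^bsub>Ds ! i\<^esub>)"
    by metis
  have phi_f_mult: "\<phi> i (f j \<otimes> x) = (if i = j then \<zero>\<^bsub>Ds ! i\<^esub> else \<phi> i x)"
    if "i < n" "x \<in> carrier R" for i j x
  proof -
    interpret D: "domain" "Ds ! i"
      by (rule domi[OF that(1)])
    have "\<phi> i x \<in> carrier (Ds ! i)"
      using ring_hom_closed[OF hom[OF that(1)] that(2)] .
    then show ?thesis
      using phi_f[OF that(1), of j] ring_hom_mult[OF hom[OF that(1)] f that(2), of j]
        D.l_null[of "\<phi> i x"] D.l_one[of "\<phi> i x"] by (cases "i = j") simp_all
  qed
  have idem: "f j \<otimes> f j = f j" for j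
    by (rule inj) (use f phi_f phi_f_mult in auto)
  \<comment> \<open>The ideal generated by \<open>f j\<close> is the kernel of \<open>\<phi> j\<close>.\<close>
  have dvd_iff: "f j divides x \<longleftrightarrow> \<phi> j x = \<zero>\<^bsub>Ds ! j\<^esub>" if "j < n" "x \<in> carrier R" for j x
  proof
    assume "f j divides x"
    then have "f j \<otimes> x = x"
      using f idem that by (simp add: idempotent_divides_iff)
    then show "\<phi> j x = \<zero>\<^bsub>Ds ! j\<^esub>"
      using phi_f_mult[OF that, of j] by simp
  next
    assume zero: "\<phi> j x = \<zero>\<^bsub>Ds ! j\<^esub>"
    have "f j \<otimes> x = x"
      by (rule inj) (use f phi_f_mult that zero in auto)
    then show "f j divides x"
      using f idem that by (simp add: idempotent_divides_iff)
  qed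
  have "prime R (f j)" if "j < n" for j
  proof (rule idempotent_primeI[OF f idem])
    interpret D: "domain" "Ds ! j"
      by (rule domi[OF that])
    show "f j \<noteq> \<one>"
      using phi_f[OF that, of j] ring_hom_one[OF hom[OF that]] D.one_not_zero by auto
    fix r s assume rs: "r \<in> carrier R" "s \<in> carrier R" "f j divides r \<otimes> s"
    have "\<phi> j r \<otimes>\<^bsub>Ds ! j\<^esub> \<phi> j s = \<zero>\<^bsub>Ds ! j\<^esub>"
      using rs that hom[OF that] by (simp add: dvd_iff ring_hom_mult)
    then show "f j divides r \<or> f j divides s"
      using rs that D.integral_iff ring_hom_closed[OF hom[OF that]] by (simp add: dvd_iff)
  qed
  moreover have "r = \<zero>" if "r \<in> carrier R" "\<forall>j<n. f j divides r" for r
    by (rule inj) (use that phi_zero dvd_iff in auto)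
  ultimately have "separating_idempotent_primes R (f ` {..<n})"
    using f idem by (auto simp: separating_idempotent_primes_def)
  then show ?thesis
    by blast
qed

lemma (in cring) product_if_separating_idempotent_primes:
  assumes "separating_idempotent_primes R F" "\<one> \<noteq> \<zero>"
  shows "finite_product_of_domains R"
proof -
  have fin: "finite F" and car: "\<And>f. f \<in> F \<Longrightarrow> f \<in> carrier R"
    and idem: "\<And>f. f \<in> F \<Longrightarrow> f \<otimes> f = f" and pr: "\<And>f. f \<in> F \<Longrightarrow> prime R f"
    and sep: "\<And>r. \<lbrakk>r \<in> carrier R; \<And>f. f \<in> F \<Longrightarrow> f divides r\<rbrakk> \<Longrightarrow> r = \<zero>"
    using assms(1) by (auto simp: separating_idempotent_primes_def)
  have "F \<noteq> {}"
    using sep[of \<one>] assms(2) by auto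
  then obtain n f where f: "f ` {i. i < Suc n} = F" "inj_on f {i. i < Suc n}"
    using finite_imp_nat_seg_image_inj_on[OF fin] by (metis (no_types) image_empty lessE less_nat_zero_code Collect_empty_eq old.nat.exhaust)
  have fF: "f i \<in> F" if "i \<le> n" for i
    using f(1) that by auto
  define I where "I i = PIdl (f i)" for i
  have mem: "x \<in> I i \<longleftrightarrow> x \<in> carrier R \<and> f i divides x" if "i \<le> n" for i x
    using car[OF fF[OF that]] by (auto simp: I_def cgenideal_def factor_def m_comm)
  have ideal: "ideal (I i) R" if "i \<le> n" for i
    unfolding I_def using car[OF fF[OF that]] by (rule cgenideal_ideal)
  have "I i <+> I j = carrier R" if ij: "i \<le> n" "j \<le> n" "i \<noteq> j" for i j
  proof -
    have ne: "f i \<noteq> f j"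
      using f(2) ij by (auto simp: inj_on_def)
    note fi = car[OF fF[OF ij(1)]] and fj = car[OF fF[OF ij(2)]]
    have "f i divides (\<one> \<ominus> f j)"
      using complements_orthogonal ne ij fF car idem pr
      by (simp add: idempotent_divides_iff_complement)
    then have "\<one> \<ominus> f j \<in> I i" "f j \<in> I j"
      using ij fj by (auto simp: mem)
    moreover have "(\<one> \<ominus> f j) \<oplus> f j = \<one>"
      using fj by algebra
    ultimately have "\<one> \<in> I i <+> I j"
      unfolding set_add_def' by force
    then show ?thesis
      using ideal.one_imp_carrier[OF add_ideals[OF ideal ideal]] ij by simp
  qed
  from chinese_remainder[of n I, OF ideal this]
  have "R Quot (\<Inter>i\<le>n. I i) \<simeq> RDirProd_list (map (\<lambda>i. R Quot I i) [0..<Suc n])"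
    by blast
  moreover have "(\<Inter>i\<le>n. I i) = {\<zero>}"
  proof -
    have "r = \<zero>" if r: "\<And>i. i \<le> n \<Longrightarrow> r \<in> I i" for r
    proof (rule sep)
      show "r \<in> carrier R" using r[of 0] mem by simp
      fix g assume "g \<in> F"
      then show "g divides r" using r f(1) mem by (metis (no_types, lifting) imageE mem_Collect_eq less_Suc_eq_le)
    qed
    moreover have "\<zero> \<in> I i" if "i \<le> n" for i
      using ideal[OF that] by (simp add: additive_subgroup.zero_closed ideal.axioms(1))
    ultimately show ?thesis by auto
  qed
  moreover have "R \<simeq> R Quot {\<zero>}"
    using FactRing_zeroideal by blast
  ultimately have "R \<simeq> RDirProd_list (map (\<lambda>i. R Quot I i) [0..<Suc n])"
    using ring_iso_trans by metis
  then show ?thesis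
  proof (rule finite_product_of_domainsI[rotated -1])
    fix S assume "S \<in> set (map (\<lambda>i. R Quot I i) [0..<Suc n])"
    then obtain i where i: "i \<le> n" "S = R Quot I i"
      by (auto simp: less_Suc_eq_le simp del: upt_Suc)
    have "primeideal (I i) R"
    proof (rule primeidealI[OF ideal[OF i(1)] cring_axioms])
      have "\<not> f i divides \<one>"
        using car idem pr fF[OF i(1)] prime_not_one[of "f i"]
        by (simp add: idempotent_divides_iff)
      then show "carrier R \<noteq> I i"
        using mem[OF i(1)] by auto
      fix a b assume "a \<in> carrier R" "b \<in> carrier R" "a \<otimes> b \<in> I i"
      then show "a \<in> I i \<or> b \<in> I i"
        using pr[OF fF[OF i(1)]] by (simp add: mem[OF i(1)] prime_def)
    qed
    then show "domain S"
      using i(2) primeideal.quotient_is_domain by blast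
  qed (auto intro: ring_axioms)
qed

section \<open>Prime factors of powers of \<open>X\<close>\<close>

lemma (in comm_monoid) prime_dividesD_pow:
  assumes "prime G p" "p \<in> carrier G" "x \<in> carrier G" "p divides (x [^] (n::nat))"
  shows "p divides x"
  using assms(4)
proof (induction n)
  case 0
  then have "p \<in> Units G"
    using assms(2) by (metis Units_one_closed divides_unit nat_pow_0)
  then show ?case
    using assms(1) by (simp add: prime_def)
next
  case (Suc n)
  then show ?case
    using assms(1,3) by (auto simp: prime_def)
qed

lemma (in monoid) foldr_mult_append:
  assumes "set xs \<subseteq> carrier G" "set ys \<subseteq> carrier G"
  shows "foldr (\<otimes>) (xs @ ys) \<one> = foldr (\<otimes>) xs \<one> \<otimes> foldr (\<otimes>) ys \<one>"
  using assms by (induction xs) (simp_all add: m_assoc)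

lemma (in monoid) product_of_primes_pow:
  assumes "product_of_primes G x"
  shows "product_of_primes G (x [^] Suc n)"
proof (induction n)
  case 0
  have "x \<in> carrier G"
    using assms by (auto simp: product_of_primes_def)
  then show ?case
    using assms by simp
next
  case (Suc n)
  obtain ps where ps: "ps \<noteq> []" "set ps \<subseteq> carrier G" "\<forall>p \<in> set ps. prime G p"
    "foldr (\<otimes>) ps \<one> = x [^] Suc n"
    using Suc by (auto simp: product_of_primes_def)
  obtain qs where qs: "set qs \<subseteq> carrier G" "\<forall>p \<in> set qs. prime G p" "foldr (\<otimes>) qs \<one> = x"
    using assms by (auto simp: product_of_primes_def)
  have "foldr (\<otimes>) (ps @ qs) \<one> = x [^] Suc (Suc n)"
    using foldr_mult_append[OF ps(2) qs(1)] ps(4) qs(3) by simp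
  then show ?case
    using ps(1-3) qs(1,2) unfolding product_of_primes_def by (intro exI[of _ "ps @ qs"]) auto
qed

context UP_cring
begin

abbreviation X where "X \<equiv> monom P \<one> 1"

lemma coeff_mult_0:
  assumes "p \<in> carrier P" "q \<in> carrier P"
  shows "coeff P (p \<otimes>\<^bsub>P\<^esub> q) 0 = coeff P p 0 \<otimes> coeff P q 0"
  using assms by simp

lemma coeff_mult_1:
  assumes "p \<in> carrier P" "q \<in> carrier P"
  shows "coeff P (p \<otimes>\<^bsub>P\<^esub> q) 1 = coeff P p 0 \<otimes> coeff P q 1 \<oplus> coeff P p 1 \<otimes> coeff P q 0"
proof -
  have "{..1} = {0, 1::nat}"
    by auto
  then show ?thesis
    using assms by simp
qed

lemma coeff_X_mult_Suc:
  assumes "q \<in> carrier P"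
  shows "coeff P (X \<otimes>\<^bsub>P\<^esub> q) (Suc n) = coeff P q n"
proof -
  have "coeff P (X \<otimes>\<^bsub>P\<^esub> q) (Suc n) =
      (\<Oplus>i \<in> {..Suc n}. if 1 = i then coeff P q (Suc n - i) else \<zero>)"
    using assms by (auto intro!: R.finsum_cong')
  also have "\<dots> = coeff P q n"
    using R.finsum_singleton[of 1 "{..Suc n}" "\<lambda>i. coeff P q (Suc n - i)"] assms by auto
  finally show ?thesis .
qed

text \<open>The cofactor is the shifted coefficient sequence; polynomials are functions on \<open>nat\<close>.\<close>

lemma coeff_0_eq_zero_imp_X_mult:
  assumes "q \<in> carrier P" "coeff P q 0 = \<zero>"
  obtains k where "k \<in> carrier P" "q = X \<otimes>\<^bsub>P\<^esub> k"
proof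
  let ?k = "\<lambda>n. coeff P q (Suc n)"
  have "bound \<zero> (deg R q) ?k"
    using assms(1) by (simp add: bound_def deg_aboveD)
  then have "?k \<in> up R"
    using assms(1) by (intro mem_upI) auto
  then show k: "?k \<in> carrier P"
    by (simp add: UP_def P_def)
  have coeff_k: "coeff P ?k n = coeff P q (Suc n)" for n
    using \<open>?k \<in> up R\<close> by (simp add: UP_def P_def)
  show "q = X \<otimes>\<^bsub>P\<^esub> ?k"
  proof (rule up_eqI)
    fix n
    show "coeff P q n = coeff P (X \<otimes>\<^bsub>P\<^esub> ?k) n"
    proof (cases n)
      case 0
      then show ?thesis
        using assms(2) k by (simp add: coeff_mult_0 del: coeff_mult)
    next
      case (Suc m)
      then show ?thesis
        using k coeff_k by (simp add: coeff_X_mult_Suc del: coeff_mult One_nat_def)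
    qed
  qed (use assms(1) k in auto)
qed

text \<open>
  In the notation \<open>X = p q\<close>, \<open>p = a + b X + \<dots>\<close>, \<open>q = c + d X + \<dots>\<close>, the idempotent is \<open>f = a d\<close>,
  with complement \<open>e = b c\<close>. It is not \<open>1\<close>, since otherwise \<open>c = 0\<close>, so \<open>q = X k\<close> and \<open>p k = 1\<close>.
  It is prime, since \<open>f\<close> divides \<open>r s\<close> iff \<open>(e r) (e s) = 0\<close>, and then the prime \<open>p\<close> divides one of
  the constants \<open>e r\<close> and \<open>e s\<close>; but \<open>0\<close> is the only constant in \<open>e R\<close> divisible by \<open>p\<close>.
\<close>

lemma idempotent_prime_of_prime_divides_X:
  assumes p: "p \<in> carrier P" "prime P p" and dvd: "p divides\<^bsub>P\<^esub> X"
  shows "\<exists>f \<in> carrier R. f \<otimes> f = f \<and> prime R f \<and> coeff P p 0 divides f"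
proof -
  obtain q where q: "q \<in> carrier P" "X = p \<otimes>\<^bsub>P\<^esub> q"
    using dvd by (auto elim: dividesE)
  define a b c d where "a = coeff P p 0" and "b = coeff P p 1" and "c = coeff P q 0" and "d = coeff P q 1"
  have car: "a \<in> carrier R" "b \<in> carrier R" "c \<in> carrier R" "d \<in> carrier R"
    using p q by (simp_all add: a_def b_def c_def d_def)
  have ac: "a \<otimes> c = \<zero>"
    using coeff_mult_0[OF p(1) q(1)] unfolding q(2)[symmetric] by (simp add: a_def c_def)
  have one: "a \<otimes> d \<oplus> b \<otimes> c = \<one>"
    using coeff_mult_1[OF p(1) q(1)] unfolding q(2)[symmetric] by (simp add: a_def b_def c_def d_def)
  define f where "f = a \<otimes> d"
  define e where "e = b \<otimes> c"
  have fe: "f \<in> carrier R" "e \<in> carrier R" "f \<oplus> e = \<one>"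
    using car one by (simp_all add: f_def e_def)
  have "f \<otimes> e = (a \<otimes> c) \<otimes> (b \<otimes> d)"
    unfolding f_def e_def using car by algebra
  then have fe0: "f \<otimes> e = \<zero>"
    using ac car by simp
  have ae0: "a \<otimes> e = \<zero>"
    using ac car R.m_lcomm[of a b c] by (simp add: e_def)
  have split: "x = f \<otimes> x \<oplus> e \<otimes> x" if "x \<in> carrier R" for x
    using that fe R.l_distr[of f e x] by simp
  have idem: "f \<otimes> f = f"
    using split[OF fe(1)] fe fe0 R.m_comm[of e f] by simp
  have dvd_iff: "f divides x \<longleftrightarrow> e \<otimes> x = \<zero>" if "x \<in> carrier R" for x
  proof -
    have "\<one> \<ominus> f = e"
      using fe by (metis R.add.inv_solve_right' R.minus_eq R.a_comm R.one_closed)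
    then show ?thesis
      using R.idempotent_divides_iff_complement[OF fe(1) that idem] by simp
  qed
  have "f \<noteq> \<one>"
  proof
    assume "f = \<one>"
    then have "e = \<zero>"
      using fe fe0 by simp
    then have "c = f \<otimes> c"
      using split[OF car(3)] car fe by simp
    also have "\<dots> = (a \<otimes> c) \<otimes> d"
      unfolding f_def using car by algebra
    finally have "c = \<zero>"
      using ac car by simp
    then obtain k where k: "k \<in> carrier P" "q = X \<otimes>\<^bsub>P\<^esub> k"
      using coeff_0_eq_zero_imp_X_mult q(1) by (auto simp: c_def)
    \<comment> \<open>Multiplication by \<open>X\<close> shifts coefficients, so \<open>X\<close> can be cancelled in \<open>X (p k) = p q = X\<close>.\<close>
    have "p \<otimes>\<^bsub>P\<^esub> k = \<one>\<^bsub>P\<^esub>"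
    proof (rule up_eqI)
      fix n
      have "X \<otimes>\<^bsub>P\<^esub> (p \<otimes>\<^bsub>P\<^esub> k) = p \<otimes>\<^bsub>P\<^esub> q"
        unfolding k(2) using p(1) k(1) by (intro P.m_lcomm) auto
      also have "\<dots> = X \<otimes>\<^bsub>P\<^esub> \<one>\<^bsub>P\<^esub>"
        unfolding q(2)[symmetric] by (rule P.r_one[symmetric]) simp
      finally have "X \<otimes>\<^bsub>P\<^esub> (p \<otimes>\<^bsub>P\<^esub> k) = X \<otimes>\<^bsub>P\<^esub> \<one>\<^bsub>P\<^esub>" .
      then have "coeff P (X \<otimes>\<^bsub>P\<^esub> (p \<otimes>\<^bsub>P\<^esub> k)) (Suc n) = coeff P (X \<otimes>\<^bsub>P\<^esub> \<one>\<^bsub>P\<^esub>) (Suc n)"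
        by (rule arg_cong)
      then show "coeff P (p \<otimes>\<^bsub>P\<^esub> k) n = coeff P \<one>\<^bsub>P\<^esub> n"
        by (simp only: coeff_X_mult_Suc P.m_closed P.one_closed p(1) k(1))
    qed (use p k in auto)
    then have "p \<in> Units P"
      using p k P.m_comm[of p k] by (auto simp: Units_def)
    then show False
      using p(2) by (simp add: prime_def)
  qed
  moreover have "f divides r \<or> f divides s"
    if rs: "r \<in> carrier R" "s \<in> carrier R" "f divides r \<otimes> s" for r s
  proof -
    have "(e \<otimes> r) \<otimes> (e \<otimes> s) = e \<otimes> (e \<otimes> (r \<otimes> s))"
      using fe rs(1,2) by algebra
    also have "\<dots> = \<zero>"
      using rs fe by (simp add: dvd_iff)
    finally have "monom P (e \<otimes> r) 0 \<otimes>\<^bsub>P\<^esub> monom P (e \<otimes> s) 0 = \<zero>\<^bsub>P\<^esub>"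
      using fe rs monom_mult[of "e \<otimes> r" "e \<otimes> s" 0 0] by simp
    then have "p divides\<^bsub>P\<^esub> monom P (e \<otimes> r) 0 \<otimes>\<^bsub>P\<^esub> monom P (e \<otimes> s) 0"
      using p(1) by (metis dividesI P.r_null P.zero_closed)
    then have "p divides\<^bsub>P\<^esub> monom P (e \<otimes> r) 0 \<or> p divides\<^bsub>P\<^esub> monom P (e \<otimes> s) 0"
      using p(2) fe rs by (simp add: prime_def)
    moreover have "e \<otimes> t = \<zero>" if "p divides\<^bsub>P\<^esub> monom P (e \<otimes> t) 0" "t \<in> carrier R" for t
    proof -
      obtain g where g: "g \<in> carrier P" "monom P (e \<otimes> t) 0 = p \<otimes>\<^bsub>P\<^esub> g"
        using \<open>p divides\<^bsub>P\<^esub> monom P (e \<otimes> t) 0\<close> by (auto elim: dividesE)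
      have et: "e \<otimes> t = a \<otimes> coeff P g 0"
        using coeff_mult_0[OF p(1) g(1)] fe that(2) unfolding g(2)[symmetric] by (simp add: a_def)
      \<comment> \<open>The constant \<open>e t\<close> is a multiple of \<open>a\<close>, and it is its own multiple by \<open>e\<close>, where \<open>a e = 0\<close>.\<close>
      have "f \<otimes> (e \<otimes> t) = \<zero>"
        using fe fe0 that(2) by (simp add: R.m_assoc[symmetric])
      then have "e \<otimes> t = e \<otimes> (e \<otimes> t)"
        using split[of "e \<otimes> t"] fe that(2) by simp
      also have "\<dots> = (a \<otimes> e) \<otimes> coeff P g 0"
        unfolding et using car fe g(1) by (simp add: R.m_ac)
      finally show ?thesis
        using ae0 g(1) by simp
    qed
    ultimately show ?thesis
      using rs by (auto simp: dvd_iff)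
  qed
  ultimately have "prime R f"
    using R.idempotent_primeI[OF fe(1) idem] by blast
  then show ?thesis
    using fe(1) idem car by (auto simp: f_def a_def)
qed

lemma separating_idempotent_primes_if_pow_X:
  assumes "product_of_primes P (X [^]\<^bsub>P\<^esub> (n::nat))" "n \<ge> 1"
  shows "\<exists>F. separating_idempotent_primes R F"
proof -
  obtain ps where ps: "set ps \<subseteq> carrier P" "\<And>p. p \<in> set ps \<Longrightarrow> prime P p"
    and prod: "foldr (\<otimes>\<^bsub>P\<^esub>) ps \<one>\<^bsub>P\<^esub> = X [^]\<^bsub>P\<^esub> n"
    using assms(1) by (auto simp: product_of_primes_def)
  have "\<exists>f \<in> carrier R. f \<otimes> f = f \<and> prime R f \<and> coeff P p 0 divides f" if "p \<in> set ps" for p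
  proof (rule idempotent_prime_of_prime_divides_X)
    show "p divides\<^bsub>P\<^esub> X"
      using that ps P.multlist_dividesI[of p ps] P.prime_dividesD_pow[of p X n] prod by auto
  qed (use that ps in auto)
  then obtain f where f: "\<And>p. p \<in> set ps \<Longrightarrow> f p \<in> carrier R"
    "\<And>p. p \<in> set ps \<Longrightarrow> f p \<otimes> f p = f p" "\<And>p. p \<in> set ps \<Longrightarrow> prime R (f p)"
    "\<And>p. p \<in> set ps \<Longrightarrow> coeff P p 0 divides f p"
    by metis
  have "r = \<zero>" if r: "r \<in> carrier R" "\<forall>p \<in> set ps. f p divides r" for r
  proof -
    \<comment> \<open>Each factor contributes one constant term, which divides \<open>f q\<close>, while \<open>f q \<otimes> r = r\<close>.\<close>
    have "coeff P (foldr (\<otimes>\<^bsub>P\<^esub>) qs \<one>\<^bsub>P\<^esub>) 0 divides r" if "set qs \<subseteq> set ps" for qs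
      using that
    proof (induction qs)
      case Nil
      then show ?case
        using r(1) by (auto intro: dividesI[of r])
    next
      case (Cons q qs)
      let ?A = "coeff P (foldr (\<otimes>\<^bsub>P\<^esub>) qs \<one>\<^bsub>P\<^esub>) 0"
      have q: "q \<in> carrier P" "foldr (\<otimes>\<^bsub>P\<^esub>) qs \<one>\<^bsub>P\<^esub> \<in> carrier P"
        using Cons.prems ps(1) by (auto intro: P.multlist_closed)
      obtain x where x: "x \<in> carrier R" "f q = coeff P q 0 \<otimes> x"
        using f(4)[of q] Cons.prems by (auto elim: dividesE)
      obtain y where y: "y \<in> carrier R" "r = ?A \<otimes> y"
        using Cons by (auto elim: dividesE)
      have "r = f q \<otimes> r"
        using R.idempotent_divides_iff[OF f(1) r(1) f(2), of q] r(2) Cons.prems by simp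
      also have "\<dots> = (coeff P q 0 \<otimes> x) \<otimes> (?A \<otimes> y)"
        by (simp only: x(2) y(2)[symmetric])
      also have "\<dots> = (coeff P q 0 \<otimes> ?A) \<otimes> (x \<otimes> y)"
        using x(1) y(1) q by (simp add: R.m_ac del: coeff_mult)
      finally have r_eq: "r = (coeff P q 0 \<otimes> ?A) \<otimes> (x \<otimes> y)" .
      have "coeff P (foldr (\<otimes>\<^bsub>P\<^esub>) (q # qs) \<one>\<^bsub>P\<^esub>) 0 = coeff P q 0 \<otimes> ?A"
        using q by (simp add: coeff_mult_0 del: coeff_mult)
      moreover have "x \<otimes> y \<in> carrier R"
        using x(1) y(1) by simp
      ultimately show ?case
        using dividesI[OF _ r_eq] by simp
    qed
    from this[of ps] have "coeff P (X [^]\<^bsub>P\<^esub> n) 0 divides r"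
      by (simp add: prod)
    moreover have "coeff P (X [^]\<^bsub>P\<^esub> n) 0 = \<zero>"
    proof -
      obtain m where "n = Suc m"
        using assms(2) by (cases n) auto
      then show ?thesis
        by (simp add: coeff_mult_0 del: coeff_mult)
    qed
    ultimately show ?thesis
      by (auto elim: dividesE)
  qed
  then have "separating_idempotent_primes R (f ` set ps)"
    using f by (auto simp: separating_idempotent_primes_def)
  then show ?thesis
    by blast
qed

section \<open>Factoring \<open>X\<close>\<close>

text \<open>
  For an idempotent \<open>f\<close> the ring splits as \<open>R = (1 - f) R \<times> f R\<close>. The polynomial \<open>(1 - f) X + f\<close> is
  \<open>X\<close> on the first factor and \<open>1\<close> on the second.
\<close>

definition partial_X where
  "partial_X f = monom P (\<one> \<ominus> f) 1 \<oplus>\<^bsub>P\<^esub> monom P f 0"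

lemma partial_X_closed [simp]: "f \<in> carrier R \<Longrightarrow> partial_X f \<in> carrier P"
  by (simp add: partial_X_def)

lemma coeff_partial_X_0 [simp]: "f \<in> carrier R \<Longrightarrow> coeff P (partial_X f) 0 = f"
  by (simp add: partial_X_def)

lemma partial_X_one: "partial_X \<one> = \<one>\<^bsub>P\<^esub>"
  proof -
  have minus: "\<one> \<ominus> \<one> = \<zero>"
    by (simp add: R.r_right_minus_eq)
  show ?thesis
    unfolding partial_X_def minus by simp
qed

lemma partial_X_zero: "partial_X \<zero> = X"
  by (simp add: partial_X_def R.minus_eq)

lemma partial_X_mult:
  assumes f: "f \<in> carrier R" and g: "g \<in> carrier R" and orth: "(\<one> \<ominus> f) \<otimes> (\<one> \<ominus> g) = \<zero>"
  shows "partial_X f \<otimes>\<^bsub>P\<^esub> partial_X g = partial_X (f \<otimes> g)"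
proof -
  have "\<one> \<ominus> f \<otimes> g = ((\<one> \<ominus> f) \<otimes> g \<oplus> f \<otimes> (\<one> \<ominus> g)) \<oplus> (\<one> \<ominus> f) \<otimes> (\<one> \<ominus> g)"
    using f g by algebra
  then have mid: "\<one> \<ominus> f \<otimes> g = (\<one> \<ominus> f) \<otimes> g \<oplus> f \<otimes> (\<one> \<ominus> g)"
    using orth f g by simp
  have "partial_X f \<otimes>\<^bsub>P\<^esub> partial_X g =
      monom P (\<one> \<ominus> f) 1 \<otimes>\<^bsub>P\<^esub> monom P (\<one> \<ominus> g) 1
      \<oplus>\<^bsub>P\<^esub> (monom P (\<one> \<ominus> f) 1 \<otimes>\<^bsub>P\<^esub> monom P g 0 \<oplus>\<^bsub>P\<^esub> monom P f 0 \<otimes>\<^bsub>P\<^esub> monom P (\<one> \<ominus> g) 1)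
      \<oplus>\<^bsub>P\<^esub> monom P f 0 \<otimes>\<^bsub>P\<^esub> monom P g 0"
    using f g by (simp add: partial_X_def P.l_distr P.r_distr P.a_ac del: monom_mult)
  also have "\<dots> = monom P ((\<one> \<ominus> f) \<otimes> (\<one> \<ominus> g)) (1 + 1)
      \<oplus>\<^bsub>P\<^esub> (monom P ((\<one> \<ominus> f) \<otimes> g) (1 + 0) \<oplus>\<^bsub>P\<^esub> monom P (f \<otimes> (\<one> \<ominus> g)) (0 + 1))
      \<oplus>\<^bsub>P\<^esub> monom P (f \<otimes> g) (0 + 0)"
    using f g by (simp only: monom_mult[symmetric] R.minus_closed R.one_closed)
  also have "\<dots> = partial_X (f \<otimes> g)"
    using f g unfolding orth partial_X_def mid by simp
  finally show ?thesis .
qed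

text \<open>
  If \<open>f\<close> divides \<open>h(0)\<close>, then \<open>e = 1 - f\<close> kills \<open>h(0)\<close>, so \<open>e h = X k\<close> for some \<open>k\<close>, and
  \<open>(e X + f) (e k + f h) = e X k + f h = h\<close>.
\<close>

lemma partial_X_divides_iff:
  assumes f: "f \<in> carrier R" "f \<otimes> f = f" and h: "h \<in> carrier P"
  shows "partial_X f divides\<^bsub>P\<^esub> h \<longleftrightarrow> f divides coeff P h 0"
proof
  assume "partial_X f divides\<^bsub>P\<^esub> h"
  then obtain k where k: "k \<in> carrier P" "h = partial_X f \<otimes>\<^bsub>P\<^esub> k"
    by (auto elim: dividesE)
  then show "f divides coeff P h 0"
    using f coeff_mult_0[of "partial_X f" k] by (auto intro!: dividesI[of "coeff P k 0"] simp del: coeff_mult)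
next
  assume dvd: "f divides coeff P h 0"
  define e where "e = \<one> \<ominus> f"
  define E F where "E = monom P e 0" and "F = monom P f 0"
  have e: "e \<in> carrier R"
    using f(1) by (simp add: e_def)
  have EF: "E \<in> carrier P" "F \<in> carrier P"
    using e f by (simp_all add: E_def F_def)
  have "e \<otimes> f = f \<ominus> f \<otimes> f" "e \<otimes> e = e \<ominus> e \<otimes> f" "e \<oplus> f = \<one>"
    unfolding e_def using f(1) by algebra+
  then have ef: "e \<otimes> f = \<zero>" "e \<otimes> e = e" "e \<oplus> f = \<one>"
    using f e by (simp_all add: R.minus_eq R.r_neg)
  have EE: "E \<otimes>\<^bsub>P\<^esub> E = E" "E \<otimes>\<^bsub>P\<^esub> F = \<zero>\<^bsub>P\<^esub>" "F \<otimes>\<^bsub>P\<^esub> F = F" "E \<oplus>\<^bsub>P\<^esub> F = \<one>\<^bsub>P\<^esub>"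
    using e f ef monom_mult[of e e 0 0] monom_mult[of e f 0 0] monom_mult[of f f 0 0]
      monom_add[of e f 0] by (simp_all add: E_def F_def)
  have "coeff P (E \<otimes>\<^bsub>P\<^esub> h) 0 = e \<otimes> coeff P h 0"
    using EF h e by (simp add: coeff_mult_0 E_def del: coeff_mult)
  also have "\<dots> = \<zero>"
    using dvd f h by (simp add: R.idempotent_divides_iff_complement e_def)
  finally obtain k where k: "k \<in> carrier P" "E \<otimes>\<^bsub>P\<^esub> h = X \<otimes>\<^bsub>P\<^esub> k"
    using coeff_0_eq_zero_imp_X_mult EF h by (metis P.m_closed)
  have X: "X \<in> carrier P"
    by simp
  have pX: "partial_X f = E \<otimes>\<^bsub>P\<^esub> X \<oplus>\<^bsub>P\<^esub> F"
    using e monom_mult[of e \<one> 0 1] by (simp add: partial_X_def E_def F_def e_def)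
  have "partial_X f \<otimes>\<^bsub>P\<^esub> (E \<otimes>\<^bsub>P\<^esub> k \<oplus>\<^bsub>P\<^esub> F \<otimes>\<^bsub>P\<^esub> h) =
      (E \<otimes>\<^bsub>P\<^esub> E) \<otimes>\<^bsub>P\<^esub> (X \<otimes>\<^bsub>P\<^esub> k) \<oplus>\<^bsub>P\<^esub> (E \<otimes>\<^bsub>P\<^esub> F) \<otimes>\<^bsub>P\<^esub> (X \<otimes>\<^bsub>P\<^esub> h \<oplus>\<^bsub>P\<^esub> k) \<oplus>\<^bsub>P\<^esub> (F \<otimes>\<^bsub>P\<^esub> F) \<otimes>\<^bsub>P\<^esub> h"
    unfolding pX using EF X k(1) h
    by (simp add: P.l_distr P.r_distr P.a_ac P.m_ac del: monom_mult)
  also have "\<dots> = E \<otimes>\<^bsub>P\<^esub> (E \<otimes>\<^bsub>P\<^esub> h) \<oplus>\<^bsub>P\<^esub> F \<otimes>\<^bsub>P\<^esub> h"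
    unfolding EE k(2)[symmetric] using EF X k(1) h by (simp del: monom_mult)
  also have "\<dots> = (E \<otimes>\<^bsub>P\<^esub> E \<oplus>\<^bsub>P\<^esub> F) \<otimes>\<^bsub>P\<^esub> h"
    using EF h by (simp add: P.l_distr P.m_assoc)
  also have "\<dots> = h"
    unfolding EE using h by simp
  finally show "partial_X f divides\<^bsub>P\<^esub> h"
    using EF k(1) h by (auto intro!: dividesI[of "E \<otimes>\<^bsub>P\<^esub> k \<oplus>\<^bsub>P\<^esub> F \<otimes>\<^bsub>P\<^esub> h"])
qed

lemma prime_partial_X:
  assumes f: "f \<in> carrier R" "f \<otimes> f = f" "prime R f"
  shows "prime P (partial_X f)"
proof -
  have "partial_X f \<notin> Units P"
  proof
    assume "partial_X f \<in> Units P"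
    then have "partial_X f divides\<^bsub>P\<^esub> \<one>\<^bsub>P\<^esub>"
      by (rule P.unit_divides) simp
    then have "f = \<one>"
      using f by (simp add: partial_X_divides_iff R.idempotent_divides_iff)
    then show False
      using f(3) R.prime_not_one by blast
  qed
  then show ?thesis
    using f unfolding prime_def by (simp add: partial_X_divides_iff coeff_mult_0 del: coeff_mult)
qed

text \<open>
  Multiplicativity applies repeatedly because \<open>(1 - f) (1 - g) = 0\<close> for every \<open>g\<close> in a list
  implies the same for the product of the list.
\<close>

lemma foldr_partial_X:
  assumes "distinct fs" "set fs \<subseteq> carrier R" "\<And>f. f \<in> set fs \<Longrightarrow> f \<otimes> f = f \<and> prime R f"
  shows "foldr (\<otimes>\<^bsub>P\<^esub>) (map partial_X fs) \<one>\<^bsub>P\<^esub> = partial_X (foldr (\<otimes>) fs \<one>)"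
  using assms
proof (induction fs)
  case Nil
  then show ?case
    by (simp add: partial_X_one)
next
  case (Cons f fs)
  have f: "f \<in> carrier R" "f \<otimes> f = f" "prime R f"
    using Cons.prems by auto
  have "(\<one> \<ominus> f) \<otimes> (\<one> \<ominus> foldr (\<otimes>) gs \<one>) = \<zero>" if "set gs \<subseteq> set fs" for gs
    using that
  proof (induction gs)
    case Nil
    then show ?case
      using f by (simp add: R.minus_eq R.r_neg)
  next
    case (Cons g gs)
    let ?g = "foldr (\<otimes>) gs \<one>"
    have g: "g \<in> carrier R" "?g \<in> carrier R"
      using Cons.prems \<open>set (f # fs) \<subseteq> carrier R\<close> by (auto intro: R.multlist_closed)
    have "g \<otimes> g = g" "prime R g" "f \<noteq> g"
      using Cons.prems \<open>distinct (f # fs)\<close> \<open>\<And>h. h \<in> set (f # fs) \<Longrightarrow> h \<otimes> h = h \<and> prime R h\<close> by auto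
    then have "(\<one> \<ominus> f) \<otimes> (\<one> \<ominus> g) = \<zero>"
      using R.complements_orthogonal[OF f g(1)] by blast
    moreover have "(\<one> \<ominus> f) \<otimes> (\<one> \<ominus> g \<otimes> ?g) =
        (\<one> \<ominus> f) \<otimes> (\<one> \<ominus> g) \<oplus> g \<otimes> ((\<one> \<ominus> f) \<otimes> (\<one> \<ominus> ?g))"
      using f(1) g by algebra
    ultimately show ?case
      using Cons g by simp
  qed
  then have "(\<one> \<ominus> f) \<otimes> (\<one> \<ominus> foldr (\<otimes>) fs \<one>) = \<zero>"
    by blast
  then show ?case
    using Cons f(1) partial_X_mult[of f "foldr (\<otimes>) fs \<one>"] by (auto intro: R.multlist_closed)
qed

lemma X_product_of_primes_if_separating_idempotent_primes:
  assumes "separating_idempotent_primes R F" "\<one> \<noteq> \<zero>"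
  shows "product_of_primes P X"
proof -
  have fin: "finite F" and car: "F \<subseteq> carrier R" and pr: "\<And>f. f \<in> F \<Longrightarrow> f \<otimes> f = f \<and> prime R f"
    and sep: "\<And>r. \<lbrakk>r \<in> carrier R; \<And>f. f \<in> F \<Longrightarrow> f divides r\<rbrakk> \<Longrightarrow> r = \<zero>"
    using assms(1) by (auto simp: separating_idempotent_primes_def)
  obtain fs where fs: "set fs = F" "distinct fs"
    using finite_distinct_list[OF fin] by blast
  have "fs \<noteq> []"
    using sep[of \<one>] assms(2) fs(1) by auto
  \<comment> \<open>Every \<open>f \<in> F\<close> divides the product of all of them.\<close>
  have "foldr (\<otimes>) fs \<one> = \<zero>"
    by (rule sep) (use fs(1) car in \<open>auto intro: R.multlist_closed R.multlist_dividesI\<close>)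
  then have "foldr (\<otimes>\<^bsub>P\<^esub>) (map partial_X fs) \<one>\<^bsub>P\<^esub> = X"
    using foldr_partial_X[OF fs(2)] fs(1) car pr by (simp add: partial_X_zero)
  then show ?thesis
    using \<open>fs \<noteq> []\<close> fs(1) car pr unfolding product_of_primes_def
    by (intro exI[of _ "map partial_X fs"]) (auto intro!: prime_partial_X)
qed

end

section \<open>The equivalence\<close>

theorem corollary4p4:
  fixes R :: "('a, 'm) ring_scheme" (structure)
  assumes "cring R" and "\<one> \<noteq> \<zero>"
  shows "(finite_product_of_domains R
           \<longleftrightarrow> product_of_primes (UP R) (UP_X R)) \<and>
         (product_of_primes (UP R) (UP_X R)
           \<longleftrightarrow> (\<forall>n::nat. n \<ge> 1 \<longrightarrow> product_of_primes (UP R) (UP_X R [^]\<^bsub>UP R\<^esub> n))) \<and>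
         ((\<forall>n::nat. n \<ge> 1 \<longrightarrow> product_of_primes (UP R) (UP_X R [^]\<^bsub>UP R\<^esub> n))
           \<longleftrightarrow> (\<exists>n::nat. n \<ge> 1 \<and> product_of_primes (UP R) (UP_X R [^]\<^bsub>UP R\<^esub> n)))"
proof -
  interpret UP_cring R "UP R"
    using assms(1) by (simp add: UP_cring_def)
  have X_def: "UP_X R = X"
    by (simp add: UP_X_def)
  have 1: "finite_product_of_domains R \<Longrightarrow> product_of_primes (UP R) X"
    using R.separating_idempotent_primes_if_product
      X_product_of_primes_if_separating_idempotent_primes assms(2) by blast
  have 2: "product_of_primes (UP R) (X [^]\<^bsub>UP R\<^esub> n)"
    if "product_of_primes (UP R) X" "n \<ge> 1" for n :: nat
    using P.product_of_primes_pow[OF that(1), of "n - 1"] that(2) by simp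
  have 3: "finite_product_of_domains R"
    if "product_of_primes (UP R) (X [^]\<^bsub>UP R\<^esub> n)" "n \<ge> 1" for n :: nat
    using separating_idempotent_primes_if_pow_X[OF that]
      R.product_if_separating_idempotent_primes assms(2) by blast
  show ?thesis
    unfolding X_def using 1 2 3 by (meson order_refl)
qed

end
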